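(* Let $k>1$ and $n_1,\dots,n_k\in\{2,3,4,\dots\}$ with $n_1-1\mid n_j-1$ for all $j\in\{1,\dots,k\}$. The metric on $F(n_1,\dots,n_k)$ with respect to the standard finite generating set $X$ is not quasi-isometric to the number of leaves, or to the number of carets, in minimal tree-pair diagram representatives. That is: there is no constant $c>0$ such that $\frac1c|x|_X\le L(x)\le c|x|_X$ for all $x\in F(n_1,\dots,n_k)$; and likewise, if $C(x)$ denotes, for each $x$, the number of carets in one of the two trees of a minimal tree-pair diagram representative of $x$ (for any choice of such tree for each $x$), there is no constant $c>0$ such that $\frac1c|x|_X\le C(x)\le c|x|_X$ for all $x\in F(n_1,\dots,n_k)$.
   Context: $F(n_1,\dots,n_k)$ is the group (product $xy=x\circ y$) of piecewise-linear orientation-preserving homeomorphisms of $[0,1]$ with finitely many breakpoints, all in $\mathbb{Z}[\frac{1}{n_1\cdots n_k}]$, and slopes in the multiplicative group $\langle n_1,\dots,n_k\rangle$. An $n$-ary caret (caret of type $n$) has one parent vertex joined by $n$ edges to $n$ child vertices, ordered from left to right. An $(n_1,\dots,n_k)$-ary tree is a rooted tree formed from finitely many (possibly zero) carets of types in $\{n_1,\dots,n_k\}$ by identifying child vertices of carets with parent vertices of other carets. Leaves are numbered $0,1,2,\dots$ from left to right. The root represents $[0,1]$, and the children of an $n$-ary caret represent, from left to right, the $n$ equal consecutive closed subintervals of the parent's interval. A tree-pair diagram $(T_-,T_+)$ is an ordered pair of such trees with equally many leaves (domain tree $T_-$, range tree $T_+$); it represents the element mapping the $i$th leaf interval of $T_-$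 affinely and increasingly onto the $i$th leaf interval of $T_+$, for all $i$. Every element is represented by some diagram. A diagram is minimal if it has the fewest leaves among all diagrams representing the same element; $L(x)$ is the number of leaves in either tree of a minimal diagram for $x$. Generators. A right $n_1$-string is a tree all of whose carets are of type $n_1$ and have an edge on the rightmost root-to-leaf path. For $j\in\{2,\dots,k\}$, $i\ge0$, $(y_j)_i$ has range tree a right $n_1$-string of $i$ carets with an $n_j$-ary caret attached to its last leaf, and domain tree the right $n_1$-string with the same number of leaves. For $j\in\{1,\dots,k\}$, $i\ge 0$, $(z_j)_i$ has range tree a right $n_1$-string of $\lfloor i/(n_1-1)\rfloor+1$ carets with an $n_j$-ary caret attached to the leaf numbered $i$, and domain tree the right $n_1$-string with the same number of leaves. The standard finite generating set is $X=\{(y_i)_0,\dots,(y_i)_{n_i-1}: 2\le i\le k\}\cup\{(z_j)_0,\dots,(z_j)_{n_j-1}:1\le j\le k\}$, and $|x|_X$ is the word length of $x$ with respect to $X$.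
   Formalization: It is additionally assumed that some n_j is not a power of n_1; otherwise, e.g. for (2,4), the group is F(n_1), and the number of carets is bi-Lipschitz equivalent to the word length, so the caret claim fails. *)

theory Defs
  imports "HOL-Analysis.Analysis" "HOL-Algebra.Bij"
begin

text \<open>
  Throughout, the parameters are \<open>k\<close> and \<open>n 1, \<dots>, n k\<close>; the values of \<open>n\<close> outside
  \<open>{1..k}\<close> are never used.
\<close>

section \<open>The group\<close>

definition breakpoint_ring :: "nat \<Rightarrow> (nat \<Rightarrow> nat) \<Rightarrow> real set" where
  "breakpoint_ring k n = {of_int a / real (\<Prod>j\<in>{1..k}. n j) ^ e | (a :: int) (e :: nat). True}"

definition slope_group :: "nat \<Rightarrow> (nat \<Rightarrow> nat) \<Rightarrow> real set" where
  "slope_group k n = {\<Prod>j\<in>{1..k}. real (n j) powi e j | e :: nat \<Rightarrow> int. True}"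

text \<open>
  \<open>P\<close> is a finite subdivision of \<open>[0,1]\<close> that contains the breakpoints of \<open>f\<close>; \<open>f\<close> is affine
  between consecutive points of \<open>P\<close>.
\<close>

definition piecewise_linear :: "nat \<Rightarrow> (nat \<Rightarrow> nat) \<Rightarrow> (real \<Rightarrow> real) \<Rightarrow> bool" where
  "piecewise_linear k n f \<longleftrightarrow>
    (\<exists>P. finite P \<and> {0, 1} \<subseteq> P \<and> P \<subseteq> {0..1} \<inter> breakpoint_ring k n \<and>
      (\<forall>a\<in>P. \<forall>b\<in>P. a < b \<and> {a<..<b} \<inter> P = {} \<longrightarrow>
        (\<exists>s\<in>slope_group k n. \<forall>t\<in>{a..b}. f t = f a + s * (t - a))))"

text \<open>
  Elements are extensional functions (\<open>undefined\<close> outside \<open>[0,1]\<close>), as in \<^const>\<open>BijGroup\<close>,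
  whose product of \<open>x\<close> and \<open>y\<close> is \<open>x \<circ> y\<close> on \<open>[0,1]\<close>.
\<close>

definition thompson_stein :: "nat \<Rightarrow> (nat \<Rightarrow> nat) \<Rightarrow> (real \<Rightarrow> real) monoid" where
  "thompson_stein k n = (BijGroup {0..1}) \<lparr>carrier :=
     {f \<in> extensional {0..1}. (\<exists>g. homeomorphism {0..1} {0..1} f g) \<and>
        strict_mono_on {0..1} f \<and> piecewise_linear k n f}\<rparr>"

definition word_length :: "('a, 'b) monoid_scheme \<Rightarrow> 'a set \<Rightarrow> 'a \<Rightarrow> nat" where
  "word_length G X x =
    (LEAST m. \<exists>ws. length ws = m \<and> set ws \<subseteq> X \<union> m_inv G ` X \<and> foldr (mult G) ws (one G) = x)"


section \<open>Trees and tree-pair diagrams\<close>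

text \<open>\<open>Caret ts\<close> is a root caret of type \<open>length ts\<close> with \<open>ts\<close> hanging from its children.\<close>

datatype ctree = Leaf | Caret "ctree list"

fun is_tree :: "nat \<Rightarrow> (nat \<Rightarrow> nat) \<Rightarrow> ctree \<Rightarrow> bool" where
  "is_tree k n Leaf = True"
| "is_tree k n (Caret ts) = (length ts \<in> n ` {1..k} \<and> (\<forall>t\<in>set ts. is_tree k n t))"

primrec leaves :: "ctree \<Rightarrow> nat" where
  "leaves Leaf = 1"
| "leaves (Caret ts) = sum_list (map leaves ts)"

primrec carets :: "ctree \<Rightarrow> nat" where
  "carets Leaf = 0"
| "carets (Caret ts) = 1 + sum_list (map carets ts)"

text \<open>
  \<open>leaf_intervals a w T\<close> lists, from left to right, the endpoints of the leaf intervals of \<open>T\<close>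
  when the root of \<open>T\<close> represents \<open>[a, a + w]\<close>; \<open>forest_intervals a w ts\<close> does so for trees
  whose roots represent the consecutive intervals \<open>[a, a + w], [a + w, a + 2 w], \<dots>\<close>.
\<close>

fun leaf_intervals :: "real \<Rightarrow> real \<Rightarrow> ctree \<Rightarrow> (real \<times> real) list"
  and forest_intervals :: "real \<Rightarrow> real \<Rightarrow> ctree list \<Rightarrow> (real \<times> real) list" where
  "leaf_intervals a w Leaf = [(a, a + w)]"
| "leaf_intervals a w (Caret ts) = forest_intervals a (w / real (length ts)) ts"
| "forest_intervals a w [] = []"
| "forest_intervals a w (t # ts) = leaf_intervals a w t @ forest_intervals (a + w) w ts"

definition leaf_interval :: "ctree \<Rightarrow> nat \<Rightarrow> real \<times> real" where
  "leaf_interval T i = leaf_intervals 0 1 T ! i"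

text \<open>\<open>S\<close> is the domain tree and \<open>T\<close> the range tree.\<close>

definition represents :: "nat \<Rightarrow> (nat \<Rightarrow> nat) \<Rightarrow> ctree \<Rightarrow> ctree \<Rightarrow> (real \<Rightarrow> real) \<Rightarrow> bool" where
  "represents k n S T x \<longleftrightarrow>
    is_tree k n S \<and> is_tree k n T \<and> leaves S = leaves T \<and> x \<in> extensional {0..1} \<and>
    (\<forall>i < leaves S. \<forall>a b c d. leaf_interval S i = (a, b) \<and> leaf_interval T i = (c, d) \<longrightarrow>
       (\<forall>t\<in>{a..b}. x t = c + (d - c) / (b - a) * (t - a)))"

definition minimal_diagram :: "nat \<Rightarrow> (nat \<Rightarrow> nat) \<Rightarrow> ctree \<Rightarrow> ctree \<Rightarrow> (real \<Rightarrow> real) \<Rightarrow> bool" where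
  "minimal_diagram k n S T x \<longleftrightarrow>
    represents k n S T x \<and> (\<forall>S' T'. represents k n S' T' x \<longrightarrow> leaves S \<le> leaves S')"

definition num_leaves :: "nat \<Rightarrow> (nat \<Rightarrow> nat) \<Rightarrow> (real \<Rightarrow> real) \<Rightarrow> nat" where
  "num_leaves k n x = (THE l. \<exists>S T. minimal_diagram k n S T x \<and> leaves S = l)"


section \<open>The standard finite generating set\<close>

definition caret :: "nat \<Rightarrow> ctree" where
  "caret m = Caret (replicate m Leaf)"

text \<open>The right \<open>p\<close>-string with the given number of carets:\<close>

primrec right_string :: "nat \<Rightarrow> nat \<Rightarrow> ctree" where
  "right_string p 0 = Leaf"
| "right_string p (Suc m) = Caret (replicate (p - 1) Leaf @ [right_string p m])"

text \<open>\<open>attach C i T\<close> replaces the leaf of \<open>T\<close> numbered \<open>i\<close> by \<open>C\<close>.\<close>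

fun attach :: "ctree \<Rightarrow> nat \<Rightarrow> ctree \<Rightarrow> ctree"
  and attach_forest :: "ctree \<Rightarrow> nat \<Rightarrow> ctree list \<Rightarrow> ctree list" where
  "attach C i Leaf = (if i = 0 then C else Leaf)"
| "attach C i (Caret ts) = Caret (attach_forest C i ts)"
| "attach_forest C i [] = []"
| "attach_forest C i (t # ts) =
     (if i < leaves t then attach C i t # ts else t # attach_forest C (i - leaves t) ts)"

text \<open>
  The right \<open>n 1\<close>-string with \<open>m\<close> carets has \<open>1 + m * (n 1 - 1)\<close> leaves, so that
  \<open>right_string (n 1) ((leaves T - 1) div (n 1 - 1))\<close> is the one with as many leaves as \<open>T\<close>.
\<close>

definition element_with_range_tree :: "nat \<Rightarrow> (nat \<Rightarrow> nat) \<Rightarrow> ctree \<Rightarrow> (real \<Rightarrow> real)" where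
  "element_with_range_tree k n T =
    (THE x. represents k n (right_string (n 1) ((leaves T - 1) div (n 1 - 1))) T x)"

definition y_gen :: "nat \<Rightarrow> (nat \<Rightarrow> nat) \<Rightarrow> nat \<Rightarrow> nat \<Rightarrow> (real \<Rightarrow> real)" where
  "y_gen k n j i = element_with_range_tree k n
     (let R = right_string (n 1) i in attach (caret (n j)) (leaves R - 1) R)"

definition z_gen :: "nat \<Rightarrow> (nat \<Rightarrow> nat) \<Rightarrow> nat \<Rightarrow> nat \<Rightarrow> (real \<Rightarrow> real)" where
  "z_gen k n j i = element_with_range_tree k n
     (attach (caret (n j)) i (right_string (n 1) (i div (n 1 - 1) + 1)))"

definition std_gens :: "nat \<Rightarrow> (nat \<Rightarrow> nat) \<Rightarrow> (real \<Rightarrow> real) set" where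
  "std_gens k n = {y_gen k n j i | j i. j \<in> {2..k} \<and> i < n j} \<union>
                  {z_gen k n j i | j i. j \<in> {1..k} \<and> i < n j}"

end

theory Submission
  imports Defs
begin

text \<open>
  Write \<open>p = n 1\<close>, let \<open>q = n j\<close> be no power of \<open>p\<close>, and let \<open>p ^ s\<close> be the largest power of \<open>p\<close>
  that is at most \<open>q\<close>; as \<open>p - 1\<close> divides \<open>q - 1\<close>, it does not divide \<open>q\<close>. On \<open>[0, 1 / p]\<close> the
  generator \<open>(z_j)\<^sub>0\<close> is multiplication by \<open>1 / q\<close>, and near \<open>0\<close> the inverse of \<open>(z_1)\<^sub>0\<close> is
  multiplication by \<open>p\<close>. So \<open>x = (z_1)\<^sub>0 ^ (- s N) (z_j)\<^sub>0 ^ N\<close> has length at most \<open>(s + 1) N\<close> and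
  slope \<open>(p ^ s / q) ^ N = (u / v) ^ N\<close> on \<open>[0, 1 / p]\<close>, where \<open>u\<close> and \<open>v\<close> are coprime and \<open>u > 1\<close>.
  In any diagram of \<open>x\<close> a leaf interval of width \<open>1 / A\<close> that meets \<open>[0, 1 / p)\<close> is mapped to
  one of width \<open>1 / B\<close> with \<open>A / B = (u / v) ^ N\<close>, hence \<open>u ^ N\<close> divides \<open>A\<close>. These leaves have
  width at most \<open>2 ^ (- N)\<close>, so the diagram has at least \<open>2 ^ N / p\<close> leaves.

  That \<open>x\<close> has a diagram at all follows by composing diagrams: two trees always have expansions with
  the same leaf intervals, namely a uniform grid with \<open>(n 1 * \<dots> * n k) ^ h\<close> cells for large \<open>h\<close>.
\<close>

text \<open>The simplifier would otherwise turn the index in \<open>n 1\<close> into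
  \<open>Suc 0\<close>, and facts about \<open>n 1\<close> would stop matching.\<close>

declare One_nat_def [simp del]

section \<open>Chains of intervals\<close>

text \<open>A subdivision of \<open>[a, b]\<close> into nondegenerate consecutive intervals.
  Inductions peel off the leftmost interval, and the strict inequality keeps every slope well
  defined.\<close>

fun chain :: "real \<Rightarrow> (real \<times> real) list \<Rightarrow> real \<Rightarrow> bool" where
  "chain a [] b \<longleftrightarrow> a = b"
| "chain a (i # I) b \<longleftrightarrow> fst i = a \<and> a < snd i \<and> chain (snd i) I b"

text \<open>The condition that \<open>represents\<close> imposes on one pair of leaves, isolated as
  a relation so that whole diagrams become \<open>list_all2\<close> statements.\<close>

definition affine_between :: "(real \<Rightarrow> real) \<Rightarrow> real \<times> real \<Rightarrow> real \<times> real \<Rightarrow> bool" where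
  "affine_between x i j \<longleftrightarrow>
     (\<forall>t\<in>{fst i..snd i}. x t = fst j + (snd j - fst j) / (snd i - fst i) * (t - fst i))"

lemma chain_le: "chain a I b \<Longrightarrow> a \<le> b"
  by (induction a I b rule: chain.induct) auto

lemma chain_append: "chain a I b \<Longrightarrow> chain b J c \<Longrightarrow> chain a (I @ J) c"
  by (induction a I b rule: chain.induct) auto

lemma chain_mem:
  "chain a I b \<Longrightarrow> i \<in> set I \<Longrightarrow> a \<le> fst i \<and> fst i < snd i \<and> snd i \<le> b"
proof (induction a I b rule: chain.induct)
  case (2 a j I b)
  then show ?case using chain_le[of "snd j" I b] by fastforce
qed simp

lemma chain_mem_disjoint:
  "chain a I b \<Longrightarrow> i \<in> set I \<Longrightarrow> j \<in> set I \<Longrightarrow> i = j \<or> snd i \<le> fst j \<or> snd j \<le> fst i"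
proof (induction a I b rule: chain.induct)
  case (2 a l I b)
  then show ?case using chain_mem[of "snd l" I b] by fastforce
qed simp

text \<open>Allows the subdivision points to be read either as left ends together with
  \<open>b\<close> or as right ends together with \<open>a\<close>.\<close>

lemma chain_endpoints: "chain a I b \<Longrightarrow> insert b (fst ` set I) = insert a (snd ` set I)"
  by (induction a I b rule: chain.induct) auto

lemma affine_between_fst: "affine_between x i j \<Longrightarrow> fst i < snd i \<Longrightarrow> x (fst i) = fst j"
  by (auto simp: affine_between_def)

lemma affine_between_snd: "affine_between x i j \<Longrightarrow> fst i < snd i \<Longrightarrow> x (snd i) = snd j"
  by (auto simp: affine_between_def)

lemma affine_between_cong:
  "affine_between x i j \<Longrightarrow> (\<And>t. fst i \<le> t \<Longrightarrow> t \<le> snd i \<Longrightarrow> y t = x t) \<Longrightarrow> affine_between y i j"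
  by (auto simp: affine_between_def)

lemma strict_mono_on_Icc_glue:
  fixes f :: "real \<Rightarrow> real"
  assumes "strict_mono_on {a..b} f" "strict_mono_on {b..c} f" "a \<le> b" "b \<le> c"
  shows "strict_mono_on {a..c} f"
proof (rule strict_mono_onI)
  fix r s assume rs: "r \<in> {a..c}" "s \<in> {a..c}" "r < s"
  consider "s \<le> b" | "b \<le> r" | "r < b" "b < s" by linarith
  then show "f r < f s"
  proof cases
    case 3
    then have "f r < f b" "f b < f s"
      using rs assms by (auto intro: strict_mono_onD)
    then show ?thesis by simp
  qed (use rs assms in \<open>auto intro: strict_mono_onD\<close>)
qed

text \<open>The condition \<open>x a = c\<close> is the induction invariant: each piece ends at the
  value at which the next range interval begins, so the increasing affine pieces glue.\<close>

lemma chain_affine_between: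
  assumes "chain a I b" "chain c J d" "list_all2 (affine_between x) I J" "x a = c"
  shows "strict_mono_on {a..b} x \<and> continuous_on {a..b} x \<and> x b = d"
  using assms(3,1,2,4)
proof (induction I J arbitrary: a c rule: list_all2_induct)
  case Nil
  then show ?case by (auto intro: strict_mono_onI)
next
  case (Cons i I j J)
  have a: "fst i = a" "a < snd i" and c: "fst j = c" "c < snd j"
    and ch: "chain (snd i) I b" "chain (snd j) J d"
    using Cons.prems by auto
  have s: "x (snd i) = snd j"
    using affine_between_snd[OF Cons.hyps(1)] a by simp
  have x: "x t = c + (snd j - c) / (snd i - a) * (t - a)" if "t \<in> {a..snd i}" for t
    using Cons.hyps(1) that unfolding affine_between_def a(1) c(1) by blast
  have "strict_mono_on {a..snd i} x"
  proof (rule strict_mono_onI)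
    fix r t assume rt: "r \<in> {a..snd i}" "t \<in> {a..snd i}" "r < t"
    have "(snd j - c) / (snd i - a) * (r - a) < (snd j - c) / (snd i - a) * (t - a)"
      using rt a c by (intro mult_strict_left_mono) auto
    then show "x r < x t" using rt x by simp
  qed
  moreover have "continuous_on {a..snd i} x"
    by (rule continuous_on_eq[of _ "\<lambda>t. c + (snd j - c) / (snd i - a) * (t - a)"])
       (use a(2) in \<open>auto intro!: continuous_intros simp: x\<close>)
  moreover have "strict_mono_on {snd i..b} x \<and> continuous_on {snd i..b} x \<and> x b = d"
    by (rule Cons.IH[OF ch s])
  moreover have le: "a \<le> snd i" "snd i \<le> b"
    using a chain_le[OF ch(1)] by auto
  moreover have "{a..b} = {a..snd i} \<union> {snd i..b}"
    using le by auto
  ultimately show ?case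
    by (metis strict_mono_on_Icc_glue continuous_on_closed_Un closed_atLeastAtMost)
qed

lemma chain_affine_between_exists:
  "length I = length J \<Longrightarrow> chain a I b \<Longrightarrow> chain c J d \<Longrightarrow> \<exists>x. list_all2 (affine_between x) I J"
proof (induction I J arbitrary: a c rule: list_induct2)
  case (Cons i I j J)
  obtain x where x: "list_all2 (affine_between x) I J"
    using Cons by fastforce
  define y where "y t = (if t \<le> snd i then fst j + (snd j - fst j) / (snd i - fst i) * (t - fst i) else x t)" for t
  have yi: "affine_between y i j"
    by (auto simp: affine_between_def y_def)
  have yx: "y t = x t" if l: "l \<in> set I" "fst l \<le> t" for l t
  \<comment> \<open>The definition of \<open>y\<close> can disagree with \<open>x\<close> on later
    pieces only at the shared point \<open>snd i\<close>. There both give \<open>snd j\<close>,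
    because the next interval of the range chain starts at \<open>snd j\<close>.\<close>
  proof (cases "t = snd i")
    case False
    then show ?thesis
      using that chain_mem[of "snd i" I b l] Cons.prems(1) by (auto simp: y_def)
  next
    case True
    then have t: "t \<le> fst l"
      using that chain_mem[of "snd i" I b l] Cons.prems(1) by auto
    obtain i' I' where I: "I = i' # I'"
      using l by (cases I) auto
    obtain j' J' where J: "J = j' # J'"
      using I Cons.hyps by (cases J) auto
    have "x (snd i) = snd j"
      using Cons.prems x affine_between_fst[of x i' j'] I J by auto
    then show ?thesis
      using True Cons.prems(1) by (auto simp: y_def)
  qed
  have "list_all2 (affine_between y) I J"
    by (rule list.rel_mono_strong[OF x]) (use affine_between_cong yx in blast)
  with yi show ?case by auto
qed auto

lemma chain_affine_between_unique:
  assumes "chain a I b" "list_all2 (affine_between x) I J" "list_all2 (affine_between y) I J"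
    and "a < b" "t \<in> {a..b}"
  shows "x t = y t"
  using assms(2,3,1,4,5)
proof (induction I J arbitrary: a rule: list_all2_induct)
  case (Cons i I j J)
  show ?case
  proof (cases "t \<le> snd i")
    case True
    then show ?thesis
      using Cons.hyps(1) Cons.prems by (auto simp: affine_between_def)
  next
    case False
    then show ?thesis
      using Cons.prems by (intro Cons.IH[of "snd i"]) auto
  qed
qed simp

text \<open>While the running bound stays below \<open>\<delta>\<close>, every piece starts left of
  \<open>\<delta>\<close> and so advances by at most \<open>\<epsilon>\<close>. Hence a chain that
  reaches far needs many pieces.\<close>

lemma chain_length_lower_bound:
  assumes "chain a I b" "\<And>i. i \<in> set I \<Longrightarrow> fst i < \<delta> \<Longrightarrow> snd i - fst i \<le> \<epsilon>"
    and "a + real (length I) * \<epsilon> < \<delta>" "\<epsilon> \<ge> 0"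
  shows "b \<le> a + real (length I) * \<epsilon>"
  using assms
proof (induction a I b rule: chain.induct)
  case (2 a i I b)
  have "a < \<delta>"
    using 2(4,5) mult_nonneg_nonneg[of "real (length (i # I))" \<epsilon>] by linarith
  then have "snd i \<le> a + \<epsilon>"
    using 2(2) 2(3)[of i] by auto
  moreover have "real (length (i # I)) * \<epsilon> = \<epsilon> + real (length I) * \<epsilon>"
    by (simp add: algebra_simps)
  ultimately show ?case
    using 2 by simp
qed simp

definition grid :: "real \<Rightarrow> real \<Rightarrow> nat \<Rightarrow> (real \<times> real) list" where
  "grid a \<delta> K = map (\<lambda>i. (a + real i * \<delta>, a + (real i + 1) * \<delta>)) [0..<K]"

lemma grid_append: "grid a \<delta> K @ grid (a + real K * \<delta>) \<delta> L = grid a \<delta> (K + L)"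
proof (rule nth_equalityI)
  fix i assume "i < length (grid a \<delta> K @ grid (a + real K * \<delta>) \<delta> L)"
  then show "(grid a \<delta> K @ grid (a + real K * \<delta>) \<delta> L) ! i = grid a \<delta> (K + L) ! i"
    by (auto simp: grid_def nth_append algebra_simps of_nat_diff)
qed (simp add: grid_def)


section \<open>Leaf intervals\<close>

lemma length_leaf_intervals [simp]: "length (leaf_intervals a w T) = leaves T"
  and length_forest_intervals: "length (forest_intervals a w ts) = sum_list (map leaves ts)"
  by (induction a w T and a w ts rule: leaf_intervals_forest_intervals.induct) auto

text \<open>Affine maps carry equal subdivisions to equal subdivisions. This reduces questions about
  subtrees to the root interval \<open>[0, 1]\<close>.\<close>

lemma leaf_intervals_scale:
  "leaf_intervals (c + d * a) (d * w) T =
     map (\<lambda>i. (c + d * fst i, c + d * snd i)) (leaf_intervals a w T)"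
  "forest_intervals (c + d * a) (d * w) ts =
     map (\<lambda>i. (c + d * fst i, c + d * snd i)) (forest_intervals a w ts)"
  by (induction a w T and a w ts rule: leaf_intervals_forest_intervals.induct)
     (auto simp: algebra_simps)

lemma leaf_intervals_unit:
  "leaf_intervals c d T = map (\<lambda>i. (c + d * fst i, c + d * snd i)) (leaf_intervals 0 1 T)"
  using leaf_intervals_scale(1)[of c d 0 1] by simp

text \<open>The main working form of \<open>represents\<close>; \<open>list_all2\<close> absorbs the
  equality of the leaf numbers.\<close>

lemma represents_iff:
  "represents k n S T x \<longleftrightarrow> is_tree k n S \<and> is_tree k n T \<and> x \<in> extensional {0..1} \<and>
     list_all2 (affine_between x) (leaf_intervals 0 1 S) (leaf_intervals 0 1 T)"
proof -
  have "(\<forall>a b c d. p = (a, b) \<and> q = (c, d) \<longrightarrow> (\<forall>t\<in>{a..b}. x t = c + (d - c) / (b - a) * (t - a)))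
          \<longleftrightarrow> affine_between x p q" for p q
    by (cases p; cases q) (simp add: affine_between_def)
  then show ?thesis
    unfolding represents_def leaf_interval_def list_all2_conv_all_nth by auto
qed

locale caret_types =
  fixes k :: nat and n :: "nat \<Rightarrow> nat"
  assumes types_ge_2: "j \<in> {1..k} \<Longrightarrow> n j \<ge> 2"
begin

lemma length_pos_of_type: "m \<in> n ` {1..k} \<Longrightarrow> m > 0"
  using types_ge_2 by fastforce

lemma chain_leaf_intervals:
  "is_tree k n T \<Longrightarrow> w > 0 \<Longrightarrow> chain a (leaf_intervals a w T) (a + w)"
  "\<forall>t\<in>set ts. is_tree k n t \<Longrightarrow> w > 0 \<Longrightarrow>
     chain a (forest_intervals a w ts) (a + w * real (length ts))"
proof (induction a w T and a w ts rule: leaf_intervals_forest_intervals.induct)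
  case (2 a w ts)
  then have "length ts > 0" using length_pos_of_type by (metis is_tree.simps(2))
  with 2 show ?case by simp
next
  case (4 a w t ts)
  then have "chain a (forest_intervals a w (t # ts)) (a + w + w * real (length ts))"
    by (auto intro: chain_append)
  then show ?case by (simp add: algebra_simps)
qed auto

lemma chain_leaf_intervals_unit: "is_tree k n T \<Longrightarrow> chain 0 (leaf_intervals 0 1 T) 1"
  using chain_leaf_intervals(1)[of T 1 0] by simp

text \<open>Widths arise from the root width only by division by caret types. This is used with
  \<open>Q\<close> saying "reciprocal of a positive integer" and "member of the slope
  group".\<close>

lemma leaf_intervals_invariant:
  assumes "\<And>w m. Q w \<Longrightarrow> m \<in> n ` {1..k} \<Longrightarrow> Q (w / real m)"
  shows "is_tree k n T \<Longrightarrow> Q w \<Longrightarrow> i \<in> set (leaf_intervals a w T) \<Longrightarrow> Q (snd i - fst i)"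
    and "\<forall>t\<in>set ts. is_tree k n t \<Longrightarrow> Q w \<Longrightarrow> i \<in> set (forest_intervals a w ts) \<Longrightarrow> Q (snd i - fst i)"
  by (induction a w T and a w ts rule: leaf_intervals_forest_intervals.induct) (use assms in auto)

lemma leaf_intervals_fst_invariant:
  assumes "\<And>w m. Q w \<Longrightarrow> m \<in> n ` {1..k} \<Longrightarrow> Q (w / real m)" and "\<And>u v. Q u \<Longrightarrow> Q v \<Longrightarrow> Q (u + v)"
  shows "is_tree k n T \<Longrightarrow> Q w \<Longrightarrow> Q a \<Longrightarrow> i \<in> set (leaf_intervals a w T) \<Longrightarrow> Q (fst i)"
    and "\<forall>t\<in>set ts. is_tree k n t \<Longrightarrow> Q w \<Longrightarrow> Q a \<Longrightarrow> i \<in> set (forest_intervals a w ts) \<Longrightarrow> Q (fst i)"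
  by (induction a w T and a w ts rule: leaf_intervals_forest_intervals.induct) (use assms in auto)

lemma leaf_width:
  assumes "is_tree k n T" "i \<in> set (leaf_intervals 0 1 T)"
  obtains A :: nat where "A > 0" "snd i - fst i = 1 / real A"
proof -
  have "\<exists>A>0. snd i - fst i = 1 / real A"
  proof (rule leaf_intervals_invariant(1)[where Q = "\<lambda>w. \<exists>A>0. w = 1 / real A", OF _ assms(1) _ assms(2)])
    show "\<exists>A>0. w / real m = 1 / real A" if w: "\<exists>A>0. w = 1 / real A" and m: "m \<in> n ` {1..k}" for w m
    proof -
      obtain A where "A > 0" "w = 1 / real A" using w by auto
      then have "A * m > 0" "w / real m = 1 / real (A * m)"
        using length_pos_of_type[OF m] by auto
      then show ?thesis by blast
    qed
  qed (auto intro: exI[of _ 1])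
  then show ?thesis using that by auto
qed

section \<open>Slopes and breakpoints of leaf intervals\<close>

lemma slope_group_divide:
  assumes "s \<in> slope_group k n" "t \<in> slope_group k n"
  shows "s / t \<in> slope_group k n"
proof -
  obtain e f where "s = (\<Prod>j\<in>{1..k}. real (n j) powi e j)" "t = (\<Prod>j\<in>{1..k}. real (n j) powi f j)"
    using assms by (auto simp: slope_group_def)
  then have "s / t = (\<Prod>j\<in>{1..k}. real (n j) powi (e j - f j))"
    using types_ge_2
    by (force simp: prod_dividef[symmetric] power_int_diff intro!: prod.cong)
  then show ?thesis by (auto simp: slope_group_def)
qed

lemma one_in_slope_group: "1 \<in> slope_group k n"
  unfolding slope_group_def by (auto intro!: exI[of _ "\<lambda>_. 0"])

lemma type_in_slope_group:
  assumes "m \<in> n ` {1..k}" shows "real m \<in> slope_group k n"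
proof -
  obtain i where i: "i \<in> {1..k}" "m = n i" using assms by auto
  have "(\<Prod>j\<in>{1..k}. real (n j) powi (if j = i then 1 else 0)) = (\<Prod>j\<in>{1..k}. if j = i then real (n j) else 1)"
    by (rule prod.cong) auto
  also have "\<dots> = real m" using i by simp
  finally have "real m = (\<Prod>j\<in>{1..k}. real (n j) powi (if j = i then 1 else 0))" by simp
  then show ?thesis
    unfolding slope_group_def mem_Collect_eq
    by (intro exI[of _ "\<lambda>j. if j = i then 1 else 0"] conjI TrueI)
qed

lemma leaf_width_in_slope_group:
  assumes "is_tree k n T" "i \<in> set (leaf_intervals 0 1 T)"
  shows "snd i - fst i \<in> slope_group k n"
  by (rule leaf_intervals_invariant(1)[OF _ assms(1) _ assms(2)])
     (auto intro: one_in_slope_group slope_group_divide type_in_slope_group)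

lemma prod_types_pos: "(\<Prod>j\<in>{1..k}. n j) > 0"
  using types_ge_2 by (fastforce intro!: prod_pos)

lemma breakpoint_ring_divide:
  assumes "a \<in> breakpoint_ring k n" "m \<in> n ` {1..k}"
  shows "a / real m \<in> breakpoint_ring k n"
proof -
  let ?M = "\<Prod>j\<in>{1..k}. n j"
  obtain z e where a: "a = of_int z / real ?M ^ e"
    using assms by (auto simp: breakpoint_ring_def)
  have "m dvd ?M" using assms(2) by auto
  then obtain q where q: "?M = m * q" by (auto simp: dvd_def)
  then have "m > 0" "q > 0" using prod_types_pos by (auto intro!: Nat.gr0I)
  then have "a / real m = of_int (z * int q) / real ?M ^ Suc e"
    unfolding a q by (simp add: field_simps)
  then show ?thesis unfolding breakpoint_ring_def by blast
qed

lemma breakpoint_ring_add: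
  assumes "a \<in> breakpoint_ring k n" "b \<in> breakpoint_ring k n"
  shows "a + b \<in> breakpoint_ring k n"
proof -
  let ?M = "\<Prod>j\<in>{1..k}. n j"
  obtain y d where a: "a = of_int y / real ?M ^ d"
    using assms by (auto simp: breakpoint_ring_def)
  obtain z e where b: "b = of_int z / real ?M ^ e"
    using assms by (auto simp: breakpoint_ring_def)
  have "a + b = of_int (y * int ?M ^ e + z * int ?M ^ d) / real ?M ^ (d + e)"
    using prod_types_pos unfolding a b by (simp add: field_simps power_add)
  then show ?thesis unfolding breakpoint_ring_def by blast
qed

lemma int_in_breakpoint_ring: "of_int z \<in> breakpoint_ring k n"
  unfolding breakpoint_ring_def by (auto intro!: exI[of _ z] exI[of _ "0::nat"])

lemma leaf_fst_in_breakpoint_ring: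
  assumes "is_tree k n T" "i \<in> set (leaf_intervals 0 1 T)"
  shows "fst i \<in> breakpoint_ring k n"
  by (rule leaf_intervals_fst_invariant(1)[OF _ _ assms(1) _ _ assms(2)])
     (use breakpoint_ring_divide breakpoint_ring_add int_in_breakpoint_ring[of 0] int_in_breakpoint_ring[of 1] in auto)

section \<open>Elements with a tree-pair diagram\<close>

lemma represents_exists:
  assumes "is_tree k n S" "is_tree k n T" "leaves S = leaves T"
  shows "\<exists>x. represents k n S T x"
proof -
  obtain x where x: "list_all2 (affine_between x) (leaf_intervals 0 1 S) (leaf_intervals 0 1 T)"
    using chain_affine_between_exists chain_leaf_intervals_unit assms by (metis length_leaf_intervals)
  have "affine_between (restrict x {0..1}) i j" if "affine_between x i j" "i \<in> set (leaf_intervals 0 1 S)" for i j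
    by (rule affine_between_cong[OF that(1)])
       (use chain_mem[OF chain_leaf_intervals_unit[OF assms(1)] that(2)] in auto)
  then have "list_all2 (affine_between (restrict x {0..1})) (leaf_intervals 0 1 S) (leaf_intervals 0 1 T)"
    by (intro list.rel_mono_strong[OF x]) blast
  then show ?thesis using assms by (auto simp: represents_iff)
qed

lemma represents_unique:
  assumes "represents k n S T x" "represents k n S T y"
  shows "x = y"
proof (rule extensionalityI)
  show "x \<in> extensional {0..1}" "y \<in> extensional {0..1}"
    using assms by (auto simp: represents_iff)
  show "x t = y t" if "t \<in> {0..1}" for t
    using chain_affine_between_unique[OF chain_leaf_intervals_unit] assms that
    by (auto simp: represents_iff)
qed

lemma represents_props:
  assumes "represents k n S T x"
  shows "strict_mono_on {0..1} x" "continuous_on {0..1} x" "x 0 = 0" "x 1 = 1"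
proof -
  let ?I = "leaf_intervals 0 1 S" and ?J = "leaf_intervals 0 1 T"
  have S: "chain 0 ?I 1" and T: "chain 0 ?J 1" and al: "list_all2 (affine_between x) ?I ?J"
    using assms chain_leaf_intervals_unit by (auto simp: represents_iff)
  obtain i I where I: "?I = i # I" using S by (cases ?I) auto
  obtain j J where J: "?J = j # J" using T by (cases ?J) auto
  have "affine_between x i j" using al I J by auto
  then show 0: "x 0 = 0"
    using affine_between_fst[of x i j] S T I J by auto
  show "strict_mono_on {0..1} x" "continuous_on {0..1} x" "x 1 = 1"
    using chain_affine_between[OF S T al 0] by auto
qed

lemma represents_image:
  assumes "represents k n S T x"
  shows "x ` {0..1} = {0..1}"
proof (intro equalityI subsetI)
  note p = represents_props[OF assms]
  fix s assume "s \<in> x ` {0..1}"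
  then obtain t where t: "t \<in> {0..1}" "s = x t" by auto
  have "mono_on {0..1} x" using p(1) by (rule strict_mono_on_imp_mono_on)
  then have "x 0 \<le> x t" "x t \<le> x 1" using t by (auto intro: mono_onD)
  then show "s \<in> {0..1}" using p t by auto
next
  note p = represents_props[OF assms]
  fix s :: real assume "s \<in> {0..1}"
  then show "s \<in> x ` {0..1}"
    using IVT'[of x 0 s 1] p by (auto simp: image_iff)
qed

text \<open>The ends of the leaf intervals of \<open>S\<close> serve as the subdivision. Consecutive
  points bound a single leaf, and the slope there is a quotient of two leaf widths.\<close>

lemma represents_piecewise_linear:
  assumes "represents k n S T x"
  shows "piecewise_linear k n x"
proof -
  let ?I = "leaf_intervals 0 1 S" and ?J = "leaf_intervals 0 1 T"
  let ?P = "insert 1 (fst ` set ?I)"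
  have tr: "is_tree k n S" "is_tree k n T" and al: "list_all2 (affine_between x) ?I ?J"
    using assms by (auto simp: represents_iff)
  have S: "chain 0 ?I 1" using chain_leaf_intervals_unit tr by auto
  have P: "?P = insert 0 (snd ` set ?I)" by (rule chain_endpoints[OF S])
  have "\<exists>s\<in>slope_group k n. \<forall>t\<in>{a..b}. x t = x a + s * (t - a)"
    if a: "a \<in> ?P" and b: "b \<in> ?P" and ab: "a < b" "{a<..<b} \<inter> ?P = {}" for a b
  proof -
    have "b \<le> 1" using b chain_mem[OF S] by fastforce
    then obtain i where i: "i \<in> set ?I" "fst i = a" using a ab by auto
    have "0 \<le> a" using i chain_mem[OF S] by fastforce
    then obtain l where l: "l \<in> set ?I" "snd l = b" using b ab unfolding P by auto
    \<comment> \<open>No subdivision point lies strictly between \<open>a\<close> and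
      \<open>b\<close>, so the leaf \<open>i\<close> starting at \<open>a\<close> reaches
      \<open>b\<close>, and the leaf \<open>l\<close> ending at \<open>b\<close> starts no later
      than \<open>a\<close>. Overlapping leaves coincide.\<close>
    have "snd i \<in> ?P" using i unfolding P by auto
    then have "b \<le> snd i" using ab chain_mem[OF S i(1)] i(2) by (meson disjoint_iff greaterThanLessThan_iff not_le)
    moreover have "fst l \<le> a" using l ab by (meson disjoint_iff greaterThanLessThan_iff not_le chain_mem[OF S] image_eqI insertI2)
    ultimately have "i = l"
      using chain_mem_disjoint[OF S i(1) l(1)] i l ab by auto
    then have ib: "i = (a, b)" using i l by (simp add: prod_eq_iff)
    obtain r where r: "r < length ?I" "?I ! r = i" using i(1) by (auto simp: in_set_conv_nth)
    define j where "j = ?J ! r"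
    have j: "affine_between x i j" "j \<in> set ?J"
      using al r by (auto simp: list_all2_conv_all_nth j_def)
    have "(snd j - fst j) / (snd i - fst i) \<in> slope_group k n"
      using tr i(1) j(2) by (intro slope_group_divide leaf_width_in_slope_group)
    moreover have "x t = x a + (snd j - fst j) / (snd i - fst i) * (t - a)" if "t \<in> {a..b}" for t
      using j(1) affine_between_fst[OF j(1)] ib ab that by (auto simp: affine_between_def)
    ultimately show ?thesis by blast
  qed
  moreover have "?P \<subseteq> {0..1} \<inter> breakpoint_ring k n"
    using chain_mem[OF S] leaf_fst_in_breakpoint_ring[OF tr(1)] int_in_breakpoint_ring[of 1] by fastforce
  moreover have "0 \<in> ?P" unfolding P by simp
  ultimately show ?thesis
    unfolding piecewise_linear_def by (intro exI[of _ ?P]) auto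
qed

lemma represents_carrier:
  assumes "represents k n S T x"
  shows "x \<in> carrier (thompson_stein k n)"
proof -
  note p = represents_props[OF assms]
  have "inj_on x {0..1}" using p(1) by (rule strict_mono_on_imp_inj_on)
  then have "\<exists>g. homeomorphism {0..1} {0..1} x g"
    using homeomorphism_compact[OF compact_Icc p(2) represents_image[OF assms]] by blast
  moreover have "x \<in> extensional {0..1}" using assms by (simp add: represents_iff)
  ultimately show ?thesis
    using p(1) represents_piecewise_linear[OF assms] by (simp add: thompson_stein_def)
qed

lemma represents_id: "is_tree k n T \<Longrightarrow> represents k n T T (restrict id {0..1})"
proof -
  assume T: "is_tree k n T"
  have "affine_between (restrict id {0..1}) i i" if "i \<in> set (leaf_intervals 0 1 T)" for i
    using chain_mem[OF chain_leaf_intervals_unit[OF T] that] by (auto simp: affine_between_def)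
  then show ?thesis
    using T by (auto simp: represents_iff list_all2_conv_all_nth)
qed

end


section \<open>Composition\<close>

text \<open>Expands all leaves at once, with one tree of \<open>Fs\<close> per leaf from left to
  right; thus one list can expand both trees of a diagram.\<close>

fun graft :: "ctree \<Rightarrow> ctree list \<Rightarrow> ctree"
  and graft_forest :: "ctree list \<Rightarrow> ctree list \<Rightarrow> ctree list" where
  "graft Leaf Fs = hd Fs"
| "graft (Caret ts) Fs = Caret (graft_forest ts Fs)"
| "graft_forest [] Fs = []"
| "graft_forest (t # ts) Fs = graft t (take (leaves t) Fs) # graft_forest ts (drop (leaves t) Fs)"

lemma length_graft_forest [simp]: "length (graft_forest ts Fs) = length ts"
  by (induction ts arbitrary: Fs) auto

lemma leaf_intervals_graft:
  "length Fs = leaves T \<Longrightarrow> leaf_intervals a w (graft T Fs) =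
     concat (map2 (\<lambda>i. leaf_intervals (fst i) (snd i - fst i)) (leaf_intervals a w T) Fs)"
  "length Fs = sum_list (map leaves ts) \<Longrightarrow> forest_intervals a w (graft_forest ts Fs) =
     concat (map2 (\<lambda>i. leaf_intervals (fst i) (snd i - fst i)) (forest_intervals a w ts) Fs)"
proof (induction a w T and a w ts arbitrary: Fs and Fs rule: leaf_intervals_forest_intervals.induct)
  case (1 a w)
  then show ?case by (cases Fs) auto
qed (auto simp: zip_append1)

lemma is_tree_graft:
  "is_tree k n T \<Longrightarrow> length Fs = leaves T \<Longrightarrow> \<forall>F\<in>set Fs. is_tree k n F \<Longrightarrow> is_tree k n (graft T Fs)"
  "\<forall>t\<in>set ts. is_tree k n t \<Longrightarrow> length Fs = sum_list (map leaves ts) \<Longrightarrow> \<forall>F\<in>set Fs. is_tree k n F \<Longrightarrow>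
     \<forall>t\<in>set (graft_forest ts Fs). is_tree k n t"
proof (induction T Fs and ts Fs rule: graft_graft_forest.induct)
  case (1 Fs)
  then show ?case by (cases Fs) auto
next
  case (4 t ts Fs)
  have "is_tree k n (graft t (take (leaves t) Fs))"
    by (rule "4.IH"(1)) (use "4.prems" in \<open>auto dest: in_set_takeD\<close>)
  moreover have "\<forall>s\<in>set (graft_forest ts (drop (leaves t) Fs)). is_tree k n s"
    by (rule "4.IH"(2)) (use "4.prems" in \<open>auto dest: in_set_dropD\<close>)
  ultimately show ?case by simp
qed auto

lemma forest_intervals_grid:
  assumes "\<And>t a. t \<in> set ts \<Longrightarrow> leaf_intervals a w t = grid a (w / real K) K" "K > 0"
  shows "forest_intervals a w ts = grid a (w / real K) (length ts * K)"
  using assms(1)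
proof (induction ts arbitrary: a)
  case (Cons t ts)
  have "forest_intervals a w (t # ts) = grid a (w / real K) K @ grid (a + w) (w / real K) (length ts * K)"
    using Cons by simp
  also have "a + w = a + real K * (w / real K)" using assms(2) by simp
  finally show ?case by (simp only: grid_append) simp
qed (simp add: grid_def)

lemma list_all2_concat:
  "list_all2 (list_all2 P) xs ys \<Longrightarrow> list_all2 P (concat xs) (concat ys)"
  using concat_transfer[of P] by (auto dest: rel_funD)

lemma affine_between_compose:
  assumes "affine_between y i j" "affine_between x j l" "fst i < snd i" "fst j < snd j"
    and "{fst i..snd i} \<subseteq> D"
  shows "affine_between (compose D x y) i l"
  unfolding affine_between_def
proof
  fix t assume t: "t \<in> {fst i..snd i}"
  \<comment> \<open>The relative position of \<open>t\<close> in \<open>i\<close>. Both affine maps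
    preserve it, which avoids multiplying slopes.\<close>
  define s where "s = (t - fst i) / (snd i - fst i)"
  have s: "0 \<le> s" "s \<le> 1" "t - fst i = s * (snd i - fst i)"
    using t assms(3) by (auto simp: s_def)
  have y: "y t = fst j + s * (snd j - fst j)"
    using assms(1,3) t by (simp add: affine_between_def s_def)
  have "0 \<le> s * (snd j - fst j)" "s * (snd j - fst j) \<le> snd j - fst j"
    using s assms(4) by (auto intro!: mult_left_le_one_le)
  then have "y t \<in> {fst j..snd j}"
    unfolding y atLeastAtMost_iff by linarith
  then have "x (y t) = fst l + (snd l - fst l) / (snd j - fst j) * (y t - fst j)"
    using assms(2) by (auto simp: affine_between_def)
  also have "\<dots> = fst l + (snd l - fst l) * s"
    using assms(4) by (simp add: y)
  also have "\<dots> = fst l + (snd l - fst l) / (snd i - fst i) * (t - fst i)"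
    using assms(3) by (simp add: s_def)
  finally show "compose D x y t = fst l + (snd l - fst l) / (snd i - fst i) * (t - fst i)"
    using t assms(5) by (auto simp: compose_def)
qed

context caret_types
begin

text \<open>An affine map matches the two subdivisions that \<open>F\<close> induces on its domain
  and its image, since both are in the same proportions.\<close>

lemma affine_between_leaf_intervals:
  assumes "affine_between x i j" "fst i < snd i" "is_tree k n F"
  shows "list_all2 (affine_between x) (leaf_intervals (fst i) (snd i - fst i) F)
           (leaf_intervals (fst j) (snd j - fst j) F)"
proof -
  define a w c v where "a = fst i" and "w = snd i - fst i" and "c = fst j" and "v = snd j - fst j"
  have w: "w > 0" using assms(2) by (simp add: w_def)
  have x: "x t = c + v / w * (t - a)" if "t \<in> {a..a + w}" for t
    using assms(1) that by (auto simp: affine_between_def a_def w_def c_def v_def)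
  have "affine_between x (a + w * fst l, a + w * snd l) (c + v * fst l, c + v * snd l)"
    if "l \<in> set (leaf_intervals 0 1 F)" for l
    unfolding affine_between_def
  proof
    have l: "0 \<le> fst l" "fst l < snd l" "snd l \<le> 1"
      using chain_mem[OF chain_leaf_intervals_unit[OF assms(3)] that] by auto
    fix t assume t: "t \<in> {fst (a + w * fst l, a + w * snd l)..snd (a + w * fst l, a + w * snd l)}"
    have "0 \<le> w * fst l" "w * snd l \<le> w * 1"
      using l w by (auto intro!: mult_left_mono mult_nonneg_nonneg)
    then have "x t = c + v / w * (t - a)" using t by (intro x) auto
    also have "\<dots> = c + v * fst l + (v * (snd l - fst l)) / (w * (snd l - fst l)) * (t - (a + w * fst l))"
      using w l by (simp add: field_simps)
    finally show "x t = fst (c + v * fst l, c + v * snd l)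
      + (snd (c + v * fst l, c + v * snd l) - fst (c + v * fst l, c + v * snd l))
        / (snd (a + w * fst l, a + w * snd l) - fst (a + w * fst l, a + w * snd l))
        * (t - fst (a + w * fst l, a + w * snd l))"
      by (simp add: algebra_simps)
  qed
  then show ?thesis
    unfolding leaf_intervals_unit[of "fst i"] leaf_intervals_unit[of "fst j"]
    by (simp add: list.rel_map list_all2_same a_def w_def c_def v_def)
qed

lemma represents_graft:
  assumes "represents k n S T x" "length Fs = leaves S" "\<forall>F\<in>set Fs. is_tree k n F"
  shows "represents k n (graft S Fs) (graft T Fs) x"
proof -
  let ?I = "leaf_intervals 0 1 S" and ?J = "leaf_intervals 0 1 T"
  have tr: "is_tree k n S" "is_tree k n T" and al: "list_all2 (affine_between x) ?I ?J"
    using assms by (auto simp: represents_iff)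
  have len: "length Fs = leaves T"
    using list_all2_lengthD[OF al] assms(2) by simp
  have "list_all2 (affine_between x) (leaf_intervals (fst (?I ! r)) (snd (?I ! r) - fst (?I ! r)) (Fs ! r))
          (leaf_intervals (fst (?J ! r)) (snd (?J ! r) - fst (?J ! r)) (Fs ! r))" if r: "r < leaves S" for r
  proof (rule affine_between_leaf_intervals)
    show "affine_between x (?I ! r) (?J ! r)"
      using al r by (auto simp: list_all2_conv_all_nth)
    have "?I ! r \<in> set ?I" using r by simp
    then show "fst (?I ! r) < snd (?I ! r)"
      using chain_mem[OF chain_leaf_intervals_unit[OF tr(1)]] by blast
    show "is_tree k n (Fs ! r)" using assms(2,3) r by auto
  qed
  then have "list_all2 (affine_between x) (leaf_intervals 0 1 (graft S Fs)) (leaf_intervals 0 1 (graft T Fs))"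
    unfolding leaf_intervals_graft(1)[OF assms(2)] leaf_intervals_graft(1)[OF len]
    using assms(2) len by (intro list_all2_concat) (auto simp: list_all2_conv_all_nth)
  then show ?thesis
    using assms is_tree_graft(1) tr len by (simp add: represents_iff)
qed

text \<open>Only the leaf intervals of the middle trees must agree: with several caret types,
  different trees can give the same subdivision.\<close>

lemma represents_trans:
  assumes "represents k n S T y" "represents k n T' U x" "leaf_intervals 0 1 T = leaf_intervals 0 1 T'"
  shows "represents k n S U (compose {0..1} x y)"
proof -
  let ?I = "leaf_intervals 0 1 S" and ?J = "leaf_intervals 0 1 T" and ?L = "leaf_intervals 0 1 U"
  have y: "list_all2 (affine_between y) ?I ?J" and x: "list_all2 (affine_between x) ?J ?L"
    and S: "chain 0 ?I 1" and T: "chain 0 ?J 1"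
    using assms chain_leaf_intervals_unit by (auto simp: represents_iff)
  have "affine_between (compose {0..1} x y) (?I ! r) (?L ! r)" if r: "r < length ?I" for r
  proof (rule affine_between_compose)
    show "affine_between y (?I ! r) (?J ! r)" "affine_between x (?J ! r) (?L ! r)"
      using x y r by (auto simp: list_all2_conv_all_nth)
    have I: "?I ! r \<in> set ?I" and J: "?J ! r \<in> set ?J"
      using r list_all2_lengthD[OF y] by (auto intro!: nth_mem)
    show "fst (?I ! r) < snd (?I ! r)" "fst (?J ! r) < snd (?J ! r)" "{fst (?I ! r)..snd (?I ! r)} \<subseteq> {0..1}"
      using chain_mem[OF S I] chain_mem[OF T J] by auto
  qed
  then have "list_all2 (affine_between (compose {0..1} x y)) ?I ?L"
    using list_all2_lengthD[OF y] list_all2_lengthD[OF x] by (auto simp: list_all2_conv_all_nth)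
  then show ?thesis using assms by (simp add: represents_iff)
qed

section \<open>Common expansions to uniform grids\<close>

text \<open>Numbers of cells of the uniform grids that are built below, with one factor for each
  level of the tree.\<close>

definition type_products :: "nat set" where
  "type_products = {prod_list ms | ms. set ms \<subseteq> n ` {1..k}}"

lemma one_in_type_products: "1 \<in> type_products"
  unfolding type_products_def by (auto intro!: exI[of _ "[]"])

lemma type_in_type_products: "m \<in> n ` {1..k} \<Longrightarrow> m \<in> type_products"
  unfolding type_products_def by (auto intro!: exI[of _ "[m]"])

lemma type_products_mult:
  assumes "K \<in> type_products" "L \<in> type_products" shows "K * L \<in> type_products"
proof -
  obtain ms ls where "K = prod_list ms" "L = prod_list ls" "set (ms @ ls) \<subseteq> n ` {1..k}"
    using assms by (auto simp: type_products_def)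
  then show ?thesis unfolding type_products_def by (metis (mono_tags, lifting) mem_Collect_eq prod_list.append)
qed

lemma type_products_pos: "K \<in> type_products \<Longrightarrow> K > 0"
proof -
  have "set ms \<subseteq> n ` {1..k} \<Longrightarrow> prod_list ms > 0" for ms
    by (induction ms) (use length_pos_of_type in auto)
  then show "K \<in> type_products \<Longrightarrow> K > 0" by (auto simp only: type_products_def)
qed

lemma prod_in_type_products: "J \<subseteq> {1..k} \<Longrightarrow> (\<Prod>j\<in>J. n j) \<in> type_products"
proof (induction J rule: infinite_finite_induct)
  case (insert i J)
  then have "n i \<in> type_products" "(\<Prod>j\<in>J. n j) \<in> type_products"
    by (auto intro: type_in_type_products simp del: atLeastAtMost_iff)
  then have "n i * (\<Prod>j\<in>J. n j) \<in> type_products"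
    by (rule type_products_mult)
  then show ?case using insert.hyps by simp
qed (use one_in_type_products in simp_all)

lemma prod_types_split:
  assumes "m \<in> n ` {1..k}"
  obtains q where "q \<in> type_products" "(\<Prod>j\<in>{1..k}. n j) = m * q"
proof -
  obtain i where i: "i \<in> {1..k}" "m = n i" using assms by auto
  show ?thesis
    by (rule that[of "\<Prod>j\<in>{1..k} - {i}. n j"])
       (use i in \<open>auto intro: prod_in_type_products simp: prod.remove\<close>)
qed

text \<open>Take the tree in which all vertices of the same depth carry carets of the same type, the
  types being the factors of \<open>K\<close>.\<close>

lemma grid_tree_exists:
  assumes "K \<in> type_products"
  shows "\<exists>F. is_tree k n F \<and> (\<forall>a w. leaf_intervals a w F = grid a (w / real K) K)"
proof -
  have "\<exists>F. is_tree k n F \<and> (\<forall>a w. leaf_intervals a w F = grid a (w / real (prod_list ms)) (prod_list ms))"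
    if "set ms \<subseteq> n ` {1..k}" for ms
    using that
  proof (induction ms)
    case Nil
    show ?case by (intro exI[of _ Leaf]) (simp add: grid_def One_nat_def)
  next
    case (Cons m ms)
    let ?K = "prod_list ms"
    obtain F where F: "is_tree k n F" "\<And>a w. leaf_intervals a w F = grid a (w / real ?K) ?K"
      using Cons by auto
    have K: "?K > 0" using Cons.prems type_products_pos[of ?K] by (auto simp: type_products_def)
    have "leaf_intervals a w (Caret (replicate m F)) = grid a (w / real (m * ?K)) (m * ?K)" for a w
      using forest_intervals_grid[of "replicate m F" "w / real m" ?K a] F K by simp
    then show ?case using F Cons.prems by (intro exI[of _ "Caret (replicate m F)"]) auto
  qed
  then show ?thesis using assms by (auto simp: type_products_def)
qed

text \<open>
  \<open>T\<close> expands to a tree whose leaf intervals are \<open>K\<close> equal parts of the root interval; the uniform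
  quantification over the root interval \<open>[a, a + w]\<close> lets subtrees be treated independently.
\<close>

definition grid_graftable :: "ctree \<Rightarrow> nat \<Rightarrow> bool" where
  "grid_graftable T K \<longleftrightarrow> (\<exists>Fs. length Fs = leaves T \<and> (\<forall>F\<in>set Fs. is_tree k n F) \<and>
     (\<forall>a w. leaf_intervals a w (graft T Fs) = grid a (w / real K) K))"

lemma grid_graftable_forest:
  assumes "\<forall>t\<in>set ts. grid_graftable t K" "K > 0"
  shows "\<exists>Fs. length Fs = sum_list (map leaves ts) \<and> (\<forall>F\<in>set Fs. is_tree k n F) \<and>
     (\<forall>a w. forest_intervals a w (graft_forest ts Fs) = grid a (w / real K) (length ts * K))"
proof -
  have "\<exists>Fs. length Fs = sum_list (map leaves ts) \<and> (\<forall>F\<in>set Fs. is_tree k n F) \<and>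
     (\<forall>t\<in>set (graft_forest ts Fs). \<forall>a w. leaf_intervals a w t = grid a (w / real K) K)"
    using assms(1)
  proof (induction ts)
    case (Cons t ts)
    obtain Fs where Fs: "length Fs = sum_list (map leaves ts)" "\<forall>F\<in>set Fs. is_tree k n F"
      "\<forall>t\<in>set (graft_forest ts Fs). \<forall>a w. leaf_intervals a w t = grid a (w / real K) K"
      using Cons by auto
    obtain Gs where Gs: "length Gs = leaves t" "\<forall>F\<in>set Gs. is_tree k n F"
      "\<forall>a w. leaf_intervals a w (graft t Gs) = grid a (w / real K) K"
      using Cons.prems by (auto simp: grid_graftable_def)
    show ?case using Fs Gs by (intro exI[of _ "Gs @ Fs"]) auto
  qed simp
  then obtain Fs where Fs: "length Fs = sum_list (map leaves ts)" "\<forall>F\<in>set Fs. is_tree k n F"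
    "\<And>t a w. t \<in> set (graft_forest ts Fs) \<Longrightarrow> leaf_intervals a w t = grid a (w / real K) K"
    by blast
  have "forest_intervals a w (graft_forest ts Fs) = grid a (w / real K) (length ts * K)" for a w
    using forest_intervals_grid[OF Fs(3) assms(2)] by simp
  then show ?thesis using Fs by blast
qed

text \<open>The free factor \<open>K\<close> makes the induction work. The arity of the root caret
  divides the product of all types, and the cofactor \<open>q\<close> is passed to the subtrees as
  part of their \<open>K\<close>.\<close>

lemma grid_graftable_exists:
  assumes "is_tree k n T"
  shows "\<exists>h. \<forall>K\<in>type_products. grid_graftable T ((\<Prod>j\<in>{1..k}. n j) ^ h * K)"
  using assms
proof (induction T)
  case Leaf
  have "grid_graftable Leaf K" if K: "K \<in> type_products" for K
  proof -
    obtain F where "is_tree k n F" "\<forall>a w. leaf_intervals a w F = grid a (w / real K) K"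
      using grid_tree_exists[OF K] by auto
    then show ?thesis unfolding grid_graftable_def by (intro exI[of _ "[F]"]) auto
  qed
  then show ?case by (intro exI[of _ 0]) auto
next
  case (Caret ts)
  let ?M = "\<Prod>j\<in>{1..k}. n j"
  have "?M \<in> type_products" using prod_in_type_products by auto
  then have pow: "?M ^ e * K \<in> type_products" if "K \<in> type_products" for e K
    using that by (induction e) (auto simp: mult.assoc intro: type_products_mult)
  have "\<forall>t\<in>set ts. \<exists>h. \<forall>K\<in>type_products. grid_graftable t (?M ^ h * K)"
    using Caret by auto
  then obtain H where H: "\<And>t K. t \<in> set ts \<Longrightarrow> K \<in> type_products \<Longrightarrow> grid_graftable t (?M ^ H t * K)"
    by metis
  \<comment> \<open>A common upper bound for the exponents of the subtrees; the surplus power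
    \<open>h - H t\<close> is absorbed into the free factor.\<close>
  define h where "h = (\<Sum>t\<in>set ts. H t)"
  have h: "grid_graftable t (?M ^ h * K)" if t: "t \<in> set ts" and K: "K \<in> type_products" for t K
  proof -
    have "H t \<le> h" unfolding h_def using t by (intro member_le_sum) auto
    then have "?M ^ h = ?M ^ H t * ?M ^ (h - H t)"
      by (metis le_add_diff_inverse power_add)
    then show ?thesis using H[OF t pow[OF K]] by (simp only: mult.assoc)
  qed
  have "length ts \<in> n ` {1..k}" using Caret.prems by simp
  then obtain q where q: "q \<in> type_products" "?M = length ts * q"
    by (rule prod_types_split)
  have "grid_graftable (Caret ts) (?M ^ Suc h * K)" if K: "K \<in> type_products" for K
  proof -
    let ?L = "?M ^ h * (q * K)"
    have qK: "q * K \<in> type_products" using q K type_products_mult by auto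
    then have "?L > 0" by (intro type_products_pos pow)
    then obtain Fs where Fs: "length Fs = sum_list (map leaves ts)" "\<forall>F\<in>set Fs. is_tree k n F"
      "\<And>a w. forest_intervals a w (graft_forest ts Fs) = grid a (w / real ?L) (length ts * ?L)"
      using grid_graftable_forest[of ts ?L] h qK by blast
    have L: "?M ^ Suc h * K = length ts * ?L" using q(2) by (simp add: mult_ac)
    have "leaf_intervals a w (graft (Caret ts) Fs) = grid a (w / real (length ts * ?L)) (length ts * ?L)" for a w
      by (simp only: graft.simps leaf_intervals.simps Fs(3) length_graft_forest of_nat_mult divide_divide_eq_left)
    then show ?thesis unfolding L grid_graftable_def using Fs by (intro exI[of _ Fs]) simp
  qed
  then show ?case by blast
qed

lemma represents_compose:
  assumes "represents k n S T y" "represents k n T' U x"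
  shows "\<exists>S' U'. represents k n S' U' (compose {0..1} x y)"
proof -
  let ?M = "\<Prod>j\<in>{1..k}. n j"
  have M: "?M ^ e \<in> type_products" for e
    by (induction e) (auto intro: one_in_type_products type_products_mult prod_in_type_products)
  obtain h h' where h: "\<forall>K\<in>type_products. grid_graftable T (?M ^ h * K)"
      "\<forall>K\<in>type_products. grid_graftable T' (?M ^ h' * K)"
    using grid_graftable_exists assms by (metis represents_iff)
  \<comment> \<open>Choosing the free factor \<open>?M ^ h'\<close> for \<open>T\<close> and
    \<open>?M ^ h\<close> for \<open>T'\<close> yields the same grid for both.\<close>
  let ?K = "?M ^ (h + h')"
  have "grid_graftable T (?M ^ h * ?M ^ h')" "grid_graftable T' (?M ^ h' * ?M ^ h)"
    using h M by blast+
  then have "grid_graftable T ?K" "grid_graftable T' ?K"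
    by (simp_all only: power_add mult.commute)
  then obtain Fs Gs where "length Fs = leaves T" "\<forall>F\<in>set Fs. is_tree k n F"
      "leaf_intervals 0 1 (graft T Fs) = grid 0 (1 / real ?K) ?K"
      "length Gs = leaves T'" "\<forall>F\<in>set Gs. is_tree k n F"
      "leaf_intervals 0 1 (graft T' Gs) = grid 0 (1 / real ?K) ?K"
    unfolding grid_graftable_def by metis
  then have "represents k n (graft S Fs) (graft U Gs) (compose {0..1} x y)"
    using assms by (intro represents_trans[of _ "graft T Fs" _ "graft T' Gs"] represents_graft)
      (auto simp: represents_def)
  then show ?thesis by blast
qed

section \<open>Products and inverses of represented elements\<close>

lemma represents_Bij:
  assumes "represents k n S T x" shows "x \<in> Bij {0..1}"
  using assms represents_image[OF assms] strict_mono_on_imp_inj_on[OF represents_props(1)[OF assms]]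
  by (auto simp: Bij_def bij_betw_def represents_iff)

lemma thompson_stein_mult:
  assumes "x \<in> Bij {0..1}" "y \<in> Bij {0..1}"
  shows "x \<otimes>\<^bsub>thompson_stein k n\<^esub> y = compose {0..1} x y"
  using assms by (simp add: thompson_stein_def BijGroup_def)

lemma thompson_stein_one: "\<one>\<^bsub>thompson_stein k n\<^esub> = restrict id {0..1}"
  by (simp add: thompson_stein_def BijGroup_def id_def)

text \<open>Exchanging the two trees inverts the map. As \<open>m_inv\<close> is a definite
  description, uniqueness is also required; it is inherited from the ambient
  \<open>BijGroup\<close>, which has the same operations.\<close>

lemma thompson_stein_inv:
  assumes x: "represents k n S T x" and y: "represents k n T S y"
  shows "inv\<^bsub>thompson_stein k n\<^esub> x = y"
proof -
  let ?G = "thompson_stein k n" and ?B = "BijGroup {0..1::real}"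
  interpret B: group ?B by (rule group_BijGroup)
  have ops: "mult ?G = mult ?B" "one ?G = one ?B" by (auto simp: thompson_stein_def)
  have bij: "x \<in> Bij {0..1}" "y \<in> Bij {0..1}" using x y represents_Bij by auto
  have "compose {0..1} x y = restrict id {0..1}" "compose {0..1} y x = restrict id {0..1}"
    using represents_unique[OF represents_trans[OF y x refl] represents_id]
      represents_unique[OF represents_trans[OF x y refl] represents_id] x y
    by (auto simp: represents_iff)
  then have xy: "x \<otimes>\<^bsub>?G\<^esub> y = \<one>\<^bsub>?G\<^esub>" "y \<otimes>\<^bsub>?G\<^esub> x = \<one>\<^bsub>?G\<^esub>"
    by (auto simp: thompson_stein_mult bij thompson_stein_one)
  have "u = y" if u: "u \<in> carrier ?G" "u \<otimes>\<^bsub>?G\<^esub> x = \<one>\<^bsub>?G\<^esub>" for u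
  proof -
    have "u \<in> carrier ?B"
      using u(1) by (auto simp: thompson_stein_def BijGroup_def Bij_def bij_betw_def homeomorphism_def
          intro: strict_mono_on_imp_inj_on)
    moreover have xy': "x \<in> carrier ?B" "y \<in> carrier ?B"
      using bij by (auto simp: BijGroup_def)
    ultimately have "inv\<^bsub>?B\<^esub> x = u"
      by (intro B.inv_equality[OF u(2)[unfolded ops]])
    then show ?thesis
      using B.inv_equality[OF xy(2)[unfolded ops] xy'] by simp
  qed
  then show ?thesis
    unfolding m_inv_def using represents_carrier[OF y] xy by (intro the_equality conjI) blast+
qed

end

section \<open>Words in the generators\<close>

lemma word_length_le:
  "set ws \<subseteq> X \<union> m_inv G ` X \<Longrightarrow> foldr (mult G) ws (one G) = x \<Longrightarrow> word_length G X x \<le> length ws"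
  unfolding word_length_def by (rule Least_le) blast

lemma leaves_right_string: "p \<ge> 1 \<Longrightarrow> leaves (right_string p m) = 1 + m * (p - 1)"
  by (induction m) (auto simp: sum_list_replicate)

context caret_types
begin

lemma represents_mult:
  assumes "\<exists>S T. represents k n S T x" "\<exists>S T. represents k n S T y"
  shows "\<exists>S T. represents k n S T (x \<otimes>\<^bsub>thompson_stein k n\<^esub> y)"
    and "t \<in> {0..1} \<Longrightarrow> (x \<otimes>\<^bsub>thompson_stein k n\<^esub> y) t = x (y t)"
  using assms represents_Bij represents_compose by (auto simp: thompson_stein_mult compose_def)

lemma represents_foldr_mult:
  assumes "\<And>x. x \<in> set ws \<Longrightarrow> \<exists>S T. represents k n S T x"
  shows "\<exists>S T. represents k n S T (foldr (mult (thompson_stein k n)) ws (one (thompson_stein k n)))"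
  using assms
proof (induction ws)
  case Nil
  have "represents k n Leaf Leaf (one (thompson_stein k n))"
    unfolding thompson_stein_one by (rule represents_id) simp
  then show ?case by auto
qed (auto intro!: represents_mult(1))

text \<open>The least leaf number is attained and is shared by all minimal diagrams, so the
  description in \<open>num_leaves\<close> denotes it.\<close>

lemma num_leaves_minimal:
  assumes "represents k n S T x"
  shows "\<exists>S T. minimal_diagram k n S T x \<and> num_leaves k n x = leaves S"
proof -
  define L where "L = (LEAST l. \<exists>S T. represents k n S T x \<and> leaves S = l)"
  have "\<exists>S T. represents k n S T x \<and> leaves S = L"
    unfolding L_def by (rule LeastI[of _ "leaves S"]) (use assms in blast)
  moreover have "L \<le> leaves S'" if "represents k n S' T' x" for S' T'
    unfolding L_def by (rule Least_le) (use that in blast)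
  ultimately obtain S T where min: "minimal_diagram k n S T x"
    by (auto simp: minimal_diagram_def)
  moreover have "num_leaves k n x = leaves S"
    unfolding num_leaves_def
  proof (rule the_equality)
    show "\<exists>S' T'. minimal_diagram k n S' T' x \<and> leaves S' = leaves S" using min by blast
    show "\<And>l. \<exists>S T. minimal_diagram k n S T x \<and> leaves S = l \<Longrightarrow> l = leaves S"
      using min unfolding minimal_diagram_def by (auto intro!: antisym)
  qed
  ultimately show ?thesis by blast
qed

section \<open>Estimates for the number of leaves\<close>

text \<open>Each caret turns one leaf into at most as many leaves as the sum of all types. This
  transfers lower bounds from leaves to carets.\<close>

lemma leaves_le_carets:
  "is_tree k n T \<Longrightarrow> leaves T \<le> 1 + (\<Sum>j\<in>{1..k}. n j) * carets T"
proof (induction T)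
  case (Caret ts)
  let ?Q = "\<Sum>j\<in>{1..k}. n j"
  obtain j where j: "j \<in> {1..k}" "length ts = n j" using Caret.prems by auto
  then have "length ts \<le> ?Q" by (simp only:) (rule member_le_sum, auto)
  moreover have "sum_list (map leaves ts) \<le> sum_list (map (\<lambda>t. 1 + ?Q * carets t) ts)"
    using Caret by (intro sum_list_mono) auto
  moreover have "sum_list (map (\<lambda>t. 1 + ?Q * carets t) ts) = length ts + ?Q * sum_list (map carets ts)"
    by (induction ts) (auto simp: algebra_simps)
  ultimately show ?case by (simp add: algebra_simps)
qed simp

lemma leaves_lower_bound:
  fixes u v N :: nat
  assumes rep: "represents k n S T x" and "0 < \<delta>" "\<delta> \<le> 1" "coprime u v" "u \<ge> 2" "v > 0"
    and x: "\<And>t. t \<in> {0..\<delta>} \<Longrightarrow> x t = (real u / real v) ^ N * t"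
  shows "\<delta> * 2 ^ N \<le> real (leaves S)"
proof (rule ccontr)
  let ?I = "leaf_intervals 0 1 S" and ?J = "leaf_intervals 0 1 T"
  assume "\<not> \<delta> * 2 ^ N \<le> real (leaves S)"
  then have small: "real (length ?I) * (1 / 2 ^ N) < \<delta>" by (simp add: field_simps)
  have tr: "is_tree k n S" "is_tree k n T" and al: "list_all2 (affine_between x) ?I ?J"
    using rep by (auto simp: represents_iff)
  have S: "chain 0 ?I 1" using chain_leaf_intervals_unit tr by auto
  have "snd i - fst i \<le> 1 / 2 ^ N" if i: "i \<in> set ?I" "fst i < \<delta>" for i
  proof -
    obtain r where r: "r < length ?I" "?I ! r = i" using i(1) by (auto simp: in_set_conv_nth)
    define j where "j = ?J ! r"
    have j: "affine_between x i j" "j \<in> set ?J"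
      using al r by (auto simp: list_all2_conv_all_nth j_def)
    obtain A where A: "A > 0" "snd i - fst i = 1 / real A" using leaf_width[OF tr(1) i(1)] .
    obtain B where B: "B > 0" "snd j - fst j = 1 / real B" using leaf_width[OF tr(2) j(2)] .
    \<comment> \<open>The leaf may extend beyond \<open>\<delta>\<close>, so the slope is read off
      on \<open>[fst i, e]\<close>, a nondegenerate segment inside both the leaf and
      \<open>[0, \<delta>]\<close>.\<close>
    define e where "e = min (snd i) \<delta>"
    have i0: "0 \<le> fst i" "fst i < snd i" using chain_mem[OF S i(1)] by auto
    then have e: "fst i < e" "e \<le> snd i" "e \<le> \<delta>" using i(2) by (auto simp: e_def)
    have "x e - x (fst i) = (snd j - fst j) / (snd i - fst i) * (e - fst i)"
      using j(1) e i0 affine_between_fst[OF j(1)] by (auto simp: affine_between_def)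
    moreover have "x e - x (fst i) = (real u / real v) ^ N * (e - fst i)"
      using e i0 by (simp add: x algebra_simps)
    ultimately have "real A / real B * (e - fst i) = (real u / real v) ^ N * (e - fst i)"
      using A B by simp
    then have "real A / real B = (real u / real v) ^ N"
      using e(1) by (metis mult_right_cancel less_numeral_extra(3) diff_gt_0_iff_gt)
    \<comment> \<open>Clearing denominators moves the equation of slopes into the naturals, where
      coprimality of \<open>u\<close> and \<open>v\<close> forces \<open>u ^ N\<close> to divide
      \<open>A\<close>.\<close>
    then have "real (A * v ^ N) = real (B * u ^ N)"
      using A B assms by (simp add: field_simps)
    then have "u ^ N dvd A * v ^ N"
      by (metis dvd_triv_right of_nat_eq_iff)
    then have "u ^ N dvd A"
      using assms by (simp add: coprime_dvd_mult_left_iff)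
    then have "u ^ N \<le> A" using A by (intro dvd_imp_le)
    moreover have "2 ^ N \<le> u ^ N" using assms by (intro power_mono) auto
    ultimately have "2 ^ N \<le> A" by simp
    then have "real (2 ^ N) \<le> real A" by (rule of_nat_mono)
    then show ?thesis unfolding A(2) using A(1) by (simp add: field_simps)
  qed
  \<comment> \<open>With so few leaves, each as narrow as shown, the chain could not reach
    \<open>1\<close>, as its total length would be below \<open>\<delta>\<close>.\<close>
  then have "1 \<le> 0 + real (length ?I) * (1 / 2 ^ N)"
    using small by (intro chain_length_lower_bound[OF S]) auto
  then show False using small assms(3) by linarith
qed

section \<open>Short words with many leaves\<close>

text \<open>Records only the first leaf pair, which determines the generator near
  \<open>0\<close>.\<close>

lemma z_gen_zero_represents:
  assumes "j \<in> {1..k}" "(n 1 - 1) dvd (n j - 1)"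
  obtains S T I J where "represents k n S T (z_gen k n j 0)"
    "leaf_intervals 0 1 S = (0, 1 / real (n 1)) # I"
    "leaf_intervals 0 1 T = (0, 1 / (real (n 1) * real (n j))) # J"
proof -
  have 1: "1 \<in> {1..k}" using assms by auto
  \<comment> \<open>Here \<open>p\<close> and \<open>q\<close> stand for \<open>n 1 - 2\<close> and
    \<open>n j - 2\<close>, so \<open>Suc p\<close> below counts the children of the root other than
    the first.\<close>
  obtain p where p: "n 1 = Suc (Suc p)" using types_ge_2[OF 1] by (metis add_2_eq_Suc le_Suc_ex)
  obtain q where q: "n j = Suc (Suc q)" using types_ge_2[OF assms(1)] by (metis add_2_eq_Suc le_Suc_ex)
  define T where "T = Caret (caret (n j) # replicate (Suc p) Leaf)"
  define S where "S = right_string (n 1) ((leaves T - 1) div (n 1 - 1))"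
  have eq: "0 div (n 1 - 1) + 1 = Suc 0"
    by (simp add: One_nat_def)
  have T: "attach (caret (n j)) 0 (right_string (n 1) (0 div (n 1 - 1) + 1)) = T"
    unfolding eq by (simp add: p T_def replicate_append_same)
  have lT: "leaves T = 1 + (n j - 1) + (n 1 - 1)"
    by (simp add: T_def caret_def sum_list_replicate p q)
  have "is_tree k n (right_string (n 1) m)" for m
    using imageI[OF 1, of n] by (induction m) (auto simp: p)
  then have tS: "is_tree k n S" by (simp add: S_def)
  have tT: "is_tree k n T"
    using assms(1) 1 p[symmetric] by (auto simp: T_def caret_def)
  \<comment> \<open>Hence the division that defines the domain string is exact, and the string has
    as many leaves as \<open>T\<close>.\<close>
  have dv: "(n 1 - 1) dvd (leaves T - 1)" using assms(2) by (simp add: lT)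
  then have "1 + (leaves T - 1) div (n 1 - 1) * (n 1 - 1) = leaves T"
    by (subst dvd_div_mult_self) (simp_all add: lT)
  then have "leaves S = leaves T"
    unfolding S_def using leaves_right_string[of "n 1"] by (simp add: p)
  then obtain x where x: "represents k n S T x"
    using represents_exists tS tT by blast
  have "z_gen k n j 0 = x"
    unfolding z_gen_def T element_with_range_tree_def S_def[symmetric]
    using x represents_unique by (intro the_equality) auto
  then have "represents k n S T (z_gen k n j 0)" using x by simp
  \<comment> \<open>The domain string has at least one caret, so its first leaf has width
    \<open>1 / n 1\<close>.\<close>
  moreover obtain m where "(leaves T - 1) div (n 1 - 1) = Suc m"
    using dv by (cases "(leaves T - 1) div (n 1 - 1)") (auto simp: lT p dvd_div_eq_0_iff)
  then have "leaf_intervals 0 1 S = (0, 1 / real (n 1)) # tl (leaf_intervals 0 1 S)"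
    by (simp add: S_def p)
  moreover have "leaf_intervals 0 1 T = (0, 1 / (real (n 1) * real (n j))) # tl (leaf_intervals 0 1 T)"
    by (simp add: T_def caret_def p q)
  ultimately show ?thesis by (rule that)
qed

lemma represents_first_leaf:
  assumes "represents k n S T x" "leaf_intervals 0 1 S = (0, b) # I" "leaf_intervals 0 1 T = (0, d) # J"
    and "t \<in> {0..b}"
  shows "x t = d / b * t"
  using assms by (auto simp: represents_iff affine_between_def)

lemma short_word_many_leaves:
  fixes s N :: nat
  assumes "j \<in> {1..k}" "(n 1 - 1) dvd (n j - 1)" "n 1 ^ s \<le> n j" "\<not> n 1 ^ s dvd n j"
  shows "\<exists>x. (\<exists>S T. represents k n S T x) \<and>
    word_length (thompson_stein k n) (std_gens k n) x \<le> (s + 1) * N \<and>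
    (\<forall>S T. represents k n S T x \<longrightarrow> 2 ^ N \<le> n 1 * leaves S)"
proof -
  let ?G = "thompson_stein k n"
  let ?p = "n 1" and ?q = "n j"
  let ?prod = "\<lambda>ws. foldr (mult ?G) ws (one ?G)"
  have one: "1 \<in> {1..k}" using assms by auto
  have pq: "?p \<ge> 2" "?q \<ge> 2" using types_ge_2 one assms by auto
  define h where "h = z_gen k n j 0"
  define z where "z = z_gen k n 1 0"
  define g where "g = inv\<^bsub>?G\<^esub> z"
  obtain S T I J where h: "represents k n S T h" "leaf_intervals 0 1 S = (0, 1 / real ?p) # I"
    "leaf_intervals 0 1 T = (0, 1 / (real ?p * real ?q)) # J"
    unfolding h_def by (rule z_gen_zero_represents[OF assms(1,2)])
  have ht: "h t = t / real ?q" if "t \<in> {0..1 / real ?p}" for t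
    using represents_first_leaf[OF h that] pq by simp
  obtain S' T' I' J' where z: "represents k n S' T' z" "leaf_intervals 0 1 S' = (0, 1 / real ?p) # I'"
    "leaf_intervals 0 1 T' = (0, 1 / (real ?p * real ?p)) # J'"
    unfolding z_def by (rule z_gen_zero_represents[OF one]) auto
  obtain y where y: "represents k n T' S' y"
    using represents_exists[of T' S'] z(1) by (auto simp: represents_def)
  have g: "represents k n T' S' g"
    using y thompson_stein_inv[OF z(1) y] by (simp add: g_def)
  \<comment> \<open>The first leaf of the domain tree of \<open>g\<close> is
    \<open>[0, 1 / ?p ^ 2]\<close>; the expansion by \<open>?p\<close> is guaranteed only
    there.\<close>
  have gt: "g t = real ?p * t" if "t \<in> {0..1 / (real ?p * real ?p)}" for t
    using represents_first_leaf[OF g z(3,2) that] pq by simp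
  have ex: "\<exists>S T. represents k n S T (?prod (replicate m g @ replicate N h))" for m N
    using g h(1) by (intro represents_foldr_mult) auto
  have le1: "1 / real ?p \<le> 1" using pq by simp
  have hN: "?prod (replicate N h) t = t / real ?q ^ N" if t: "t \<in> {0..1 / real ?p}" for t
  proof (induction N)
    case 0
    show ?case using t le1 by (simp add: thompson_stein_one)
  next
    case (Suc N)
    have "?prod (replicate (Suc N) h) t = h (?prod (replicate N h) t)"
      using represents_mult(2)[of h "?prod (replicate N h)" t] h(1) ex[of 0] t le1 by auto
    also have "\<dots> = t / real ?q ^ N / real ?q"
      unfolding Suc
    proof (rule ht)
      have "t / real ?q ^ N \<le> t / 1" using t pq by (intro divide_left_mono) auto
      then show "t / real ?q ^ N \<in> {0..1 / real ?p}" using t by auto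
    qed
    finally show ?case by simp
  qed
  \<comment> \<open>The factors \<open>h\<close> act first and contract. The condition
    \<open>?p ^ m \<le> ?q ^ N\<close> keeps the point inside \<open>[0, 1 / ?p ^ 2]\<close> before
    each application of \<open>g\<close>.\<close>
  have gm: "?prod (replicate m g @ replicate N h) t = real ?p ^ m * t / real ?q ^ N"
    if t: "t \<in> {0..1 / real ?p}" and m: "?p ^ m \<le> ?q ^ N" for t m
    using m
  proof (induction m)
    case 0
    show ?case using hN[OF t] by simp
  next
    case (Suc m)
    have "?p ^ m \<le> ?p ^ Suc m" using pq by (intro power_increasing) auto
    then have IH: "?prod (replicate m g @ replicate N h) t = real ?p ^ m * t / real ?q ^ N"
      using Suc.prems by (intro Suc.IH) (rule le_trans)
    have "?prod (replicate (Suc m) g @ replicate N h) t = g (?prod (replicate m g @ replicate N h) t)"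
      using represents_mult(2)[of g "?prod (replicate m g @ replicate N h)" t] g ex[of m N] t le1 by auto
    also have "\<dots> = real ?p * (real ?p ^ m * t / real ?q ^ N)"
      unfolding IH
    proof (rule gt)
      have "real ?p ^ m * t \<le> real ?p ^ m * (1 / real ?p)" using t by (intro mult_left_mono) auto
      also have "\<dots> = real (?p ^ Suc m) * (1 / (real ?p * real ?p))" using pq by (simp add: field_simps)
      also have "\<dots> \<le> real (?q ^ N) * (1 / (real ?p * real ?p))"
        using Suc.prems by (intro mult_right_mono of_nat_mono) auto
      finally show "real ?p ^ m * t / real ?q ^ N \<in> {0..1 / (real ?p * real ?p)}"
        using t pq by (simp add: field_simps)
    qed
    finally show ?case by simp
  qed
  \<comment> \<open>Brings \<open>?p ^ s / ?q\<close> to lowest terms \<open>u / v\<close>;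
    \<open>u = 1\<close> would mean that \<open>?p ^ s\<close> divides \<open>?q\<close>.\<close>
  define d where "d = gcd (?p ^ s) ?q"
  obtain u v where uv: "?p ^ s = u * d" "?q = v * d" "coprime u v"
    using gcd_coprime_exists[of "?p ^ s" ?q] pq unfolding d_def by auto
  have pos: "u > 0" "v > 0" "d > 0" using uv pq by (auto intro!: Nat.gr0I)
  have "u \<noteq> 1" using assms(4) uv by auto
  with pos have u2: "u \<ge> 2" by simp
  define x where "x = ?prod (replicate (s * N) g @ replicate N h)"
  have "?p ^ (s * N) \<le> ?q ^ N" using assms(3) by (simp add: power_mult power_mono)
  then have xt: "x t = (real u / real v) ^ N * t" if "t \<in> {0..1 / real ?p}" for t
  proof -
    have "x t = real ?p ^ (s * N) * t / real ?q ^ N"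
      unfolding x_def by (rule gm[OF that]) fact
    also have "real ?p ^ (s * N) = (real u * real d) ^ N"
      by (simp add: power_mult uv(1)[symmetric] flip: of_nat_mult of_nat_power)
    also have "real ?q ^ N = (real v * real d) ^ N" by (simp add: uv(2))
    finally show ?thesis using pos by (simp add: power_mult_distrib power_divide)
  qed
  have "\<exists>S T. represents k n S T x" unfolding x_def by (rule ex)
  moreover have "word_length ?G (std_gens k n) x \<le> (s + 1) * N"
  proof -
    have "h \<in> std_gens k n" "z \<in> std_gens k n"
      using assms(1) one pq unfolding std_gens_def h_def z_def by fastforce+
    then have "word_length ?G (std_gens k n) x \<le> length (replicate (s * N) g @ replicate N h)"
      by (intro word_length_le) (auto simp: x_def g_def)
    then show ?thesis by (simp add: algebra_simps)
  qed
  moreover have "2 ^ N \<le> ?p * leaves S" if "represents k n S T x" for S T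
  proof -
    have "1 / real ?p * 2 ^ N \<le> real (leaves S)"
      using pq by (intro leaves_lower_bound[OF that _ le1 uv(3) u2 pos(2) xt]) auto
    then have "real (2 ^ N) \<le> real (?p * leaves S)" using pq by (simp add: field_simps)
    then show ?thesis by (simp only: of_nat_le_iff)
  qed
  ultimately show ?thesis by blast
qed

end

section \<open>Arithmetic: powers, divisibility and growth\<close>

text \<open>
  If \<open>p ^ s \<le> q < p ^ (s + 1)\<close> and \<open>q = p ^ s * r\<close>, then \<open>r \<equiv> q \<equiv> 1\<close> modulo \<open>p - 1\<close>, hence \<open>r = 1\<close>.
\<close>

lemma power_le_not_dvd:
  fixes p q :: nat
  assumes "p \<ge> 2" "q \<ge> 1" "(p - 1) dvd (q - 1)" "\<And>e. q \<noteq> p ^ e"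
  shows "\<exists>s. p ^ s \<le> q \<and> \<not> p ^ s dvd q"
proof -
  obtain s where s: "p ^ s \<le> q" "q < p ^ (s + 1)"
    using ex_power_ivl1[of p q] assms by auto
  have "\<not> p ^ s dvd q"
  proof
    assume "p ^ s dvd q"
    then obtain r where r: "q = p ^ s * r" by (auto simp: dvd_def)
    have "r \<ge> 1" using r assms(2) by (cases r) auto
    have "p ^ s * r < p ^ s * p" using s(2) unfolding r power_add power_one_right .
    then have "r < p" by simp
    \<comment> \<open>The aim is \<open>r - 1 = (q - 1) - r * (p ^ s - 1)\<close>, in which both
      terms are multiples of \<open>p - 1\<close>. The integers avoid truncated subtraction.\<close>
    have "(int p - 1) dvd (int p ^ s - 1)"
      using power_diff_1_eq[of "int p" s] by (metis dvd_triv_left)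
    then have "(int p - 1) dvd (int r * (int p ^ s - 1))" by simp
    moreover have "(int p - 1) dvd (int q - 1)"
    proof -
      have "int (p - 1) dvd int (q - 1)" using assms(3) by (simp only: int_dvd_int_iff)
      then show ?thesis using assms(1,2) by (simp add: of_nat_diff)
    qed
    ultimately have "(int p - 1) dvd ((int q - 1) - int r * (int p ^ s - 1))"
      by (rule dvd_diff[rotated])
    then have "(int p - 1) dvd (int r - 1)" by (simp add: r algebra_simps)
    then have "\<not> (0 < int r - 1 \<and> int r - 1 < int p - 1)"
      using zdvd_not_zless by blast
    then have "r = 1" using \<open>r \<ge> 1\<close> \<open>r < p\<close> by linarith
    then show False using r assms(4)[of s] by simp
  qed
  with s show ?thesis by blast
qed

text \<open>Take \<open>N = 2 * (m + 1)\<close> with \<open>m \<ge> 2 * c\<close>: squaring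
  \<open>m + 1 < 2 ^ (m + 1)\<close> gives \<open>2 ^ N > (m + 1) ^ 2\<close>, which is at least
  \<open>c * N\<close>.\<close>

lemma power_2_not_linearly_bounded:
  fixes c :: real
  shows "\<exists>N\<ge>1. 2 ^ N > c * real N"
proof -
  obtain m :: nat where m: "2 * c \<le> real m" using real_arch_simple by blast
  have "real m * real m \<le> real m * 2 ^ m" "real m * 2 ^ m < 2 ^ m * (2 ^ m :: real)" for m
    using of_nat_less_two_power[of m, where 'a = real] by (auto intro!: mult_left_mono)
  then have "real (m + 1) * real (m + 1) < 2 ^ (m + 1) * 2 ^ (m + 1)"
    by (meson le_less_trans)
  moreover have "c * real (2 * (m + 1)) \<le> real (m + 1) * real (m + 1)"
    using mult_right_mono[OF m, of "real (m + 1)"] by (simp add: algebra_simps)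
  moreover have "(2::real) ^ (2 * (m + 1)) = 2 ^ (m + 1) * 2 ^ (m + 1)"
    by (simp only: mult_2 power_add)
  ultimately have "2 ^ (2 * (m + 1)) > c * real (2 * (m + 1))"
    by linarith
  moreover have "2 * (m + 1) \<ge> 1" by simp
  ultimately show ?thesis by blast
qed

theorem theorem5p2:
  fixes k :: nat and n :: "nat \<Rightarrow> nat"
  assumes "k > 1"
    and "\<forall>j\<in>{1..k}. n j \<ge> 2"
    and "\<forall>j\<in>{1..k}. (n 1 - 1) dvd (n j - 1)"
    and "\<exists>j\<in>{1..k}. \<forall>e. n j \<noteq> n 1 ^ e"
  shows "\<not> (\<exists>c>0::real. \<forall>x\<in>carrier (thompson_stein k n).
            1 / c * real (word_length (thompson_stein k n) (std_gens k n) x) \<le> real (num_leaves k n x) \<and>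
            real (num_leaves k n x) \<le> c * real (word_length (thompson_stein k n) (std_gens k n) x))
       \<and> (\<forall>C :: (real \<Rightarrow> real) \<Rightarrow> nat.
            (\<forall>x\<in>carrier (thompson_stein k n).
               \<exists>S T. minimal_diagram k n S T x \<and> (C x = carets S \<or> C x = carets T)) \<longrightarrow>
            \<not> (\<exists>c>0::real. \<forall>x\<in>carrier (thompson_stein k n).
                 1 / c * real (word_length (thompson_stein k n) (std_gens k n) x) \<le> real (C x) \<and>
                 real (C x) \<le> c * real (word_length (thompson_stein k n) (std_gens k n) x)))"
proof -
  let ?G = "thompson_stein k n"
  let ?len = "word_length ?G (std_gens k n)"
  interpret caret_types k n by standard (use assms(2) in blast)
  obtain j where j: "j \<in> {1..k}" "\<And>e. n j \<noteq> n 1 ^ e" using assms(4) by blast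
  have dv: "(n 1 - 1) dvd (n j - 1)" using assms(3) j by blast
  obtain s where s: "n 1 ^ s \<le> n j" "\<not> n 1 ^ s dvd n j"
    using power_le_not_dvd[of "n 1" "n j"] types_ge_2[of 1] types_ge_2[of j] assms(1) j dv by auto
  \<comment> \<open>Treats both counts at once: \<open>D\<close> is any size that linearly bounds
    the leaves of some diagram. Leaf numbers use \<open>a = 0\<close> and \<open>b = 1\<close>;
    caret numbers use \<open>a = 1\<close> and the sum of the types as \<open>b\<close>.\<close>
  have unbounded: False
    if D: "\<And>x S T. represents k n S T x \<Longrightarrow> \<exists>S T. represents k n S T x \<and> real (leaves S) \<le> a + b * real (D x)"
      and c: "\<And>x. x \<in> carrier ?G \<Longrightarrow> real (D x) \<le> c * real (?len x)"
      and "a \<ge> 0" "b \<ge> 0" "c > 0"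
    for D :: "(real \<Rightarrow> real) \<Rightarrow> nat" and a b c :: real
  proof -
    obtain N where N: "N \<ge> 1" "2 ^ N > real (n 1) * (a + b * (c * real (s + 1))) * real N"
      using power_2_not_linearly_bounded by blast
    obtain x S0 T0 where x: "represents k n S0 T0 x" "?len x \<le> (s + 1) * N"
      "\<And>S T. represents k n S T x \<Longrightarrow> 2 ^ N \<le> n 1 * leaves S"
      using short_word_many_leaves[OF j(1) dv s, of N] by blast
    have xG: "x \<in> carrier ?G" by (rule represents_carrier[OF x(1)])
    obtain S T where S: "represents k n S T x" "real (leaves S) \<le> a + b * real (D x)"
      using D[OF x(1)] by blast
    have "real (D x) \<le> c * real ((s + 1) * N)"
      using c[OF xG] mult_left_mono[OF of_nat_mono[OF x(2), where 'a = real], of c] \<open>c > 0\<close> by linarith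
    then have "b * real (D x) \<le> b * (c * real ((s + 1) * N))"
      using \<open>b \<ge> 0\<close> by (rule mult_left_mono)
    then have "real (leaves S) \<le> a * 1 + b * (c * real ((s + 1) * N))"
      using S(2) by linarith
    \<comment> \<open>As \<open>N \<ge> 1\<close>, the constant \<open>a\<close> is absorbed into a
      bound linear in \<open>N\<close>, which the choice of \<open>N\<close> contradicts.\<close>
    also have "\<dots> \<le> a * real N + b * (c * real ((s + 1) * N))"
      using N(1) \<open>a \<ge> 0\<close> by (intro add_right_mono mult_left_mono) auto
    also have "\<dots> = (a + b * (c * real (s + 1))) * real N" by (simp add: algebra_simps)
    finally have "real (n 1) * real (leaves S) \<le> real (n 1) * (a + b * (c * real (s + 1))) * real N"
      unfolding mult.assoc by (intro mult_left_mono) auto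
    moreover have "(2::real) ^ N \<le> real (n 1) * real (leaves S)"
      using of_nat_mono[OF x(3)[OF S(1)], where 'a = real] by simp
    ultimately show False using N(2) by linarith
  qed
  show ?thesis
  proof (intro conjI allI impI notI)
    assume "\<exists>c>0::real. \<forall>x\<in>carrier ?G. 1 / c * real (?len x) \<le> real (num_leaves k n x) \<and>
      real (num_leaves k n x) \<le> c * real (?len x)"
    then obtain c where c: "c > 0" "\<And>x. x \<in> carrier ?G \<Longrightarrow> real (num_leaves k n x) \<le> c * real (?len x)"
      by blast
    have "\<exists>S T. represents k n S T x \<and> real (leaves S) \<le> 0 + 1 * real (num_leaves k n x)"
      if "represents k n S T x" for x S T
      using num_leaves_minimal[OF that] by (auto simp: minimal_diagram_def)
    then show False
      using c(2) by (rule unbounded) (use c(1) in auto)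
  next
    fix C :: "(real \<Rightarrow> real) \<Rightarrow> nat"
    assume C: "\<forall>x\<in>carrier ?G. \<exists>S T. minimal_diagram k n S T x \<and> (C x = carets S \<or> C x = carets T)"
      and "\<exists>c>0::real. \<forall>x\<in>carrier ?G. 1 / c * real (?len x) \<le> real (C x) \<and> real (C x) \<le> c * real (?len x)"
    then obtain c where c: "c > 0" "\<And>x. x \<in> carrier ?G \<Longrightarrow> real (C x) \<le> c * real (?len x)"
      by blast
    let ?Q = "\<Sum>j\<in>{1..k}. n j"
    have "\<exists>S T. represents k n S T x \<and> real (leaves S) \<le> 1 + real ?Q * real (C x)"
      if x: "represents k n S T x" for x S T
    proof -
      obtain S T where ST: "minimal_diagram k n S T x" "C x = carets S \<or> C x = carets T"
        using C represents_carrier[OF x] by blast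
      then have rep: "represents k n S T x" by (simp add: minimal_diagram_def)
      \<comment> \<open>The two trees have equally many leaves, so the estimate holds whichever of
        them \<open>C\<close> counts.\<close>
      then have "leaves S \<le> 1 + ?Q * C x"
        using ST(2) leaves_le_carets[of S] leaves_le_carets[of T] by (auto simp: represents_def)
      then have "real (leaves S) \<le> real (1 + ?Q * C x)" by (rule of_nat_mono)
      then show ?thesis using rep by auto
    qed
    then show False
      using c(2) by (rule unbounded) (use c(1) in \<open>auto intro: sum_nonneg\<close>)
  qed
qed

end
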